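(* Let $f,g:[0,1]\to\mathbb{R}$ be functions, differentiable almost everywhere, satisfying: (B1) $f(0)=g(0)=1$ and $f(1)=g(1)=0$; (B2) $f$ and $g$ are strictly decreasing; (B3) $f$ and $g$ are concave (concave down); (B4) $f(u)\,\bigl(1-v g'(v)\bigr)+g(v)\,\bigl(1-u f'(u)\bigr)\le \max\{a,b\}+1$ for $(u,v)\in S=[0,1]^2$, where $a=-f'(1)$ and $b=-g'(1)$. For $\theta\in\mathbb{R}$ let $$D_\theta(u,v)=\frac{uv}{1-\theta f(u)g(v)},\qquad 0\le u,v\le 1.$$ Let $$G(u,v)=\bigl(f(u)-uf'(u)\bigr)\bigl(g(v)-vg'(v)\bigr)-2uv\,f'(u)g'(v),\qquad \alpha_1=\min_{S}G,\quad \alpha_2=\max_{S}G.$$ Then, for every $\theta\in\mathbb{R}$, $$D_\theta \text{ is a valid copula}\iff \theta\in\left[\frac1{\alpha_1},\frac1{\alpha_2}\right].$$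
   Context: Write $I=[0,1]$ and $S=I^2$. A function $C:S\to I$ is a (valid) bivariate copula if: (1) $C(u,0)=C(0,v)=0$, $C(u,1)=u$, $C(1,v)=v$ for all $u,v\in I$; and (2) $\dfrac{\partial^2 C}{\partial u\,\partial v}\ge 0$ on $S$, where the derivatives involved are assumed to exist almost everywhere and the inequality is required wherever they exist. In particular, being a copula includes that $D_\theta$ takes values in $[0,1]$. Conventions: derivatives at the endpoints $0$ and $1$ are one-sided; the derivatives $f'(1)$ and $g'(1)$ are assumed to exist and be finite. Expressions and inequalities involving $f'$ or $g'$ (in particular $G$ and condition (B4)) are considered at the points of $S$ where $f'(u)$ and $g'(v)$ exist, and the minimum and maximum of $G$ over these points are assumed to exist. When the denominator of $D_\theta$ vanishes at $(0,0)$ (i.e. $\theta=1$), $D_\theta(0,0)$ is taken to be $0$. *)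

theory Defs
  imports "HOL-Analysis.Analysis"
begin

text \<open>All functions on \<open>[0,1]\<close> and \<open>[0,1]\<^sup>2\<close> are total functions on the reals of which only the
  restriction matters. Derivatives are therefore taken within \<open>[0,1]\<close>: two-sided at interior
  points, one-sided at \<open>0\<close> and \<open>1\<close>.\<close>

abbreviation I01 :: "real set" where
  "I01 \<equiv> {0..1}"

abbreviation differentiable01 :: "(real \<Rightarrow> real) \<Rightarrow> real \<Rightarrow> bool" where
  "differentiable01 f x \<equiv> f differentiable (at x within I01)"

text \<open>Meaningful only where \<^term>\<open>differentiable01 f x\<close> holds.\<close>

definition deriv01 :: "(real \<Rightarrow> real) \<Rightarrow> real \<Rightarrow> real" where
  "deriv01 f x = vector_derivative f (at x within I01)"

text \<open>\<open>has_mixed_partial C u v d\<close>: the derivative \<open>\<partial>/\<partial>u (\<partial>C/\<partial>v)\<close> exists at \<open>(u, v)\<close> and equals \<open>d\<close>.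
  The inner derivative \<open>h x = \<partial>C/\<partial>v (x, v)\<close> has to exist at \<open>u\<close> and at all points \<open>x\<close> of
  \<open>[0,1]\<close> near \<open>u\<close>.\<close>

definition has_mixed_partial :: "(real \<Rightarrow> real \<Rightarrow> real) \<Rightarrow> real \<Rightarrow> real \<Rightarrow> real \<Rightarrow> bool" where
  "has_mixed_partial C u v d \<longleftrightarrow>
    (\<exists>h. (\<forall>\<^sub>F x in nhds u. x \<in> I01 \<longrightarrow> (C x has_real_derivative h x) (at v within I01)) \<and>
         (h has_real_derivative d) (at u within I01))"

definition copula :: "(real \<Rightarrow> real \<Rightarrow> real) \<Rightarrow> bool" where
  "copula C \<longleftrightarrow>
    (\<forall>u\<in>I01. \<forall>v\<in>I01. C u v \<in> I01) \<and>
    (\<forall>u\<in>I01. C u 0 = 0 \<and> C u 1 = u) \<and>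
    (\<forall>v\<in>I01. C 0 v = 0 \<and> C 1 v = v) \<and>
    (AE (u, v) in lborel. u \<in> I01 \<and> v \<in> I01 \<longrightarrow> (\<exists>d. has_mixed_partial C u v d)) \<and>
    (\<forall>u\<in>I01. \<forall>v\<in>I01. \<forall>d. has_mixed_partial C u v d \<longrightarrow> d \<ge> 0)"

text \<open>Since \<open>x / 0 = 0\<close>, this gives \<open>D 1 0 0 = 0\<close> when \<open>f 0 = g 0 = 1\<close>, which is the intended
  convention. If \<open>f\<close>, \<open>g\<close> decrease from 1 to 0, a zero of the denominator at any other point of
  the square requires \<open>\<theta> > 1\<close>; for concave \<open>f\<close>, \<open>g\<close> the function then takes negative values close
  to the origin, so the value assigned at such zeros never decides whether it is a copula.\<close>

definition D :: "(real \<Rightarrow> real) \<Rightarrow> (real \<Rightarrow> real) \<Rightarrow> real \<Rightarrow> real \<Rightarrow> real \<Rightarrow> real" where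
  "D f g \<theta> u v = u * v / (1 - \<theta> * f u * g v)"

definition G :: "(real \<Rightarrow> real) \<Rightarrow> (real \<Rightarrow> real) \<Rightarrow> real \<Rightarrow> real \<Rightarrow> real" where
  "G f g u v =
    (f u - u * deriv01 f u) * (g v - v * deriv01 g v) - 2 * u * v * deriv01 f u * deriv01 g v"

definition G_values :: "(real \<Rightarrow> real) \<Rightarrow> (real \<Rightarrow> real) \<Rightarrow> real set" where
  "G_values f g =
    {G f g u v | u v. u \<in> I01 \<and> v \<in> I01 \<and> differentiable01 f u \<and> differentiable01 g v}"

end

theory Submission
  imports Defs
begin

text \<open>Concavity gives \<open>f - u f' \<ge> 1\<close> and \<open>- a \<le> f' \<le> 0\<close>, and likewise for \<open>g\<close>. Hence
  \<open>(1 - f)(1 - g) \<le> u v f' g'\<close>, which together with (B4) yields \<open>- a b \<le> G \<le> max a b\<close>; both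
  bounds are attained at corners of the square, so \<open>\<alpha>\<^sub>1 = - a b\<close> and \<open>\<alpha>\<^sub>2 = max a b\<close>.
  The mixed partial derivative of \<open>D\<^sub>\<theta>\<close> is
  \<open>((1 - \<theta> f g)(1 - \<theta> G) + 2 \<theta>\<^sup>2 f g u v f' g') / (1 - \<theta> f g)\<^sup>3\<close>. It is nonnegative for
  \<open>1/\<alpha>\<^sub>1 \<le> \<theta> \<le> 1/\<alpha>\<^sub>2\<close>, and at the corners \<open>(1,1)\<close>, \<open>(1,0)\<close>, \<open>(0,1)\<close> it equals \<open>1 + \<theta> a b\<close>,
  \<open>1 - \<theta> a\<close>, \<open>1 - \<theta> b\<close>, which forces these bounds on \<open>\<theta>\<close>. At points where \<open>f\<close> or \<open>g\<close> is not
  differentiable but the mixed partial of \<open>D\<^sub>\<theta>\<close> still exists, it is computed from one-sided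
  derivatives, which concave functions always have.\<close>

section \<open>Null sets and derivatives on the unit interval\<close>

text \<open>The exceptional points lie in two strips with a null base, and such strips are null in
  the plane.\<close>

lemma AE_pair_lborelI:
  fixes P Q :: "real \<Rightarrow> bool"
  assumes P: "AE x in lborel. P x" and Q: "AE y in lborel. Q y"
  shows "AE (x, y) in lborel. P x \<and> Q y"
proof -
  obtain N where N: "\<And>x. x \<notin> N \<Longrightarrow> P x" "N \<in> null_sets lborel"
    using P by (elim AE_E3) auto
  obtain M where M: "\<And>y. y \<notin> M \<Longrightarrow> Q y" "M \<in> null_sets lborel"
    using Q by (elim AE_E3) auto
  have "N \<times> UNIV \<in> null_sets (lborel \<Otimes>\<^sub>M (lborel :: real measure))"
    "UNIV \<times> M \<in> null_sets ((lborel :: real measure) \<Otimes>\<^sub>M lborel)"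
    using N(2) M(2) by (auto simp: null_sets_def lborel.emeasure_pair_measure_Times)
  then have "N \<times> UNIV \<union> UNIV \<times> M \<in> null_sets (lborel :: (real \<times> real) measure)"
    by (auto simp: lborel_prod)
  then show ?thesis
    by (rule AE_I') (use N M in auto)
qed

lemma at_within_I01_neq_bot: "u \<in> I01 \<Longrightarrow> at u within I01 \<noteq> bot"
  using islimpt_Icc[of 0 1 u] by (simp add: trivial_limit_within)

lemma differentiable01_deriv01:
  assumes "differentiable01 f u"
  shows "(f has_real_derivative deriv01 f u) (at u within I01)"
  using assms vector_derivative_works
  by (auto simp: deriv01_def has_real_derivative_iff_has_vector_derivative)

lemma deriv01_eqI:
  assumes "(f has_real_derivative p) (at u within I01)" "u \<in> I01"
  shows "deriv01 f u = p"
proof (rule has_field_derivative_unique[OF differentiable01_deriv01 assms(1)])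
  show "differentiable01 f u"
    using assms(1) by (auto simp: real_differentiable_def)
qed (rule at_within_I01_neq_bot[OF assms(2)])

text \<open>The right derivative, except that at \<open>1\<close> it is the left derivative.\<close>

definition one_side :: "real \<Rightarrow> real set" where
  "one_side u = (if u < 1 then {u<..} \<inter> I01 else I01)"

lemma one_side_subset: "one_side u \<subseteq> I01"
  by (auto simp: one_side_def)

lemma at_within_one_side_neq_bot:
  assumes "u \<in> I01" shows "at u within one_side u \<noteq> bot"
proof (cases "u < 1")
  case True
  then have "one_side u = {u<..1}" using assms by (auto simp: one_side_def)
  then show ?thesis using True islimpt_Ioc[of u 1 u] by (simp add: trivial_limit_within)
next
  case False
  then show ?thesis using assms at_within_I01_neq_bot by (simp add: one_side_def)
qed

section \<open>Tangents and chords of concave functions\<close>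

text \<open>Concavity keeps the difference quotient along the segment from \<open>x\<close> to
  \<open>y\<close> above \<open>f y - f x\<close>, and its limit at \<open>x\<close> is
  \<open>p * (y - x)\<close>. Only the segment inside \<open>S\<close> is used, so \<open>x\<close>
  may be an endpoint.\<close>

lemma concave_on_tangent_above:
  fixes f :: "real \<Rightarrow> real"
  assumes f: "concave_on S f" and xy: "x \<in> S" "y \<in> S"
    and der: "(f has_real_derivative p) (at x within S)"
  shows "f y \<le> f x + p * (y - x)"
proof -
  define \<gamma> where "\<gamma> t = x + t * (y - x)" for t
  have \<gamma>S: "\<gamma> ` {0..1} \<subseteq> S"
  proof
    fix z assume "z \<in> \<gamma> ` {0..1}"
    then obtain t where "z = \<gamma> t" "0 \<le> t" "t \<le> 1" by auto
    moreover have "\<gamma> t = (1 - t) *\<^sub>R x + t *\<^sub>R y" by (simp add: \<gamma>_def algebra_simps)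
    moreover have "convex S" using f by (simp add: concave_on_iff)
    ultimately show "z \<in> S"
      using convexD_alt[of S x y t] xy by simp
  qed
  have "(f has_real_derivative p) (at (\<gamma> 0) within \<gamma> ` {0..1})"
    using DERIV_subset[OF der \<gamma>S] by (simp add: \<gamma>_def)
  moreover have "(\<gamma> has_real_derivative (y - x)) (at 0 within {0..1})"
    unfolding \<gamma>_def by (auto intro!: derivative_eq_intros)
  ultimately have "((\<lambda>t. f (\<gamma> t)) has_real_derivative p * (y - x)) (at 0 within {0..1})"
    using DERIV_image_chain[of f p \<gamma> 0 "{0..1}" "y - x"] by (simp add: o_def)
  then have lim: "((\<lambda>t. (f (\<gamma> t) - f x) / t) \<longlongrightarrow> p * (y - x)) (at 0 within {0..1})"
    by (simp add: has_field_derivative_iff \<gamma>_def)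
  have "f y - f x \<le> (f (\<gamma> t) - f x) / t" if "t \<in> {0<..1}" for t
    using concave_onD[OF f, of t x y] that xy
    by (simp add: \<gamma>_def field_simps)
  then have "\<forall>\<^sub>F t in at 0 within {0..1}. f y - f x \<le> (f (\<gamma> t) - f x) / t"
    by (auto simp: eventually_at_filter intro!: always_eventually)
  then have "f y - f x \<le> p * (y - x)"
    using tendsto_lowerbound[OF lim] at_within_I01_neq_bot[of 0] by simp
  then show ?thesis by simp
qed

text \<open>Both inequalities are the concavity inequality at the intermediate point
  \<open>y\<close>, rearranged in two ways.\<close>

lemma concave_on_slope_antimono:
  fixes f :: "real \<Rightarrow> real"
  assumes f: "concave_on S f" and S: "x \<in> S" "z \<in> S" and xyz: "x < y" "y \<le> z"
  shows "(f z - f x) / (z - x) \<le> (f y - f x) / (y - x)"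
    and "y < z \<Longrightarrow> (f z - f y) / (z - y) \<le> (f y - f x) / (y - x)"
proof -
  define t where "t = (y - x) / (z - x)"
  have t: "0 \<le> t" "t \<le> 1" "t * (z - x) = y - x"
    using xyz by (simp_all add: t_def)
  have "(1 - t) *\<^sub>R x + t *\<^sub>R z = y"
    using t(3) by (simp add: algebra_simps)
  then have "(1 - t) * f x + t * f z \<le> f y"
    using concave_onD[OF f t(1,2) S] by simp
  then have "(z - x) * ((1 - t) * f x + t * f z) \<le> (z - x) * f y"
    using xyz by (intro mult_left_mono) auto
  also have "(z - x) * ((1 - t) * f x + t * f z) = (z - x - t * (z - x)) * f x + t * (z - x) * f z"
    by (simp add: algebra_simps)
  finally have *: "(z - y) * f x + (y - x) * f z \<le> (z - x) * f y"
    unfolding t(3) by simp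
  show "(f z - f x) / (z - x) \<le> (f y - f x) / (y - x)"
    using * xyz by (simp add: field_simps)
  show "(f z - f y) / (z - y) \<le> (f y - f x) / (y - x)" if "y < z"
    using * xyz that by (simp add: field_simps)
qed

section \<open>One-sided derivatives of a single generator\<close>

locale generator =
  fixes f :: "real \<Rightarrow> real" and a :: real
  assumes at_0: "f 0 = 1" and at_1: "f 1 = 0"
    and anti: "strict_antimono_on I01 f"
    and concave: "concave_on I01 f"
    and deriv_at_1: "(f has_real_derivative - a) (at 1 within I01)"
    and AE_differentiable: "AE x in lborel. x \<in> I01 \<longrightarrow> differentiable01 f x"
begin

lemma less: "u \<in> I01 \<Longrightarrow> v \<in> I01 \<Longrightarrow> u < v \<Longrightarrow> f v < f u"
  using anti by (auto simp: monotone_on_def)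

lemma range: "u \<in> I01 \<Longrightarrow> 0 \<le> f u" "u \<in> I01 \<Longrightarrow> f u \<le> 1" "u \<in> I01 \<Longrightarrow> 0 < u \<Longrightarrow> f u < 1"
  using less[of u 1] less[of 0 u] at_0 at_1 by (cases "u = 0"; cases "u = 1"; force)+

lemma upper_at_1: "u \<in> I01 \<Longrightarrow> f u \<le> a * (1 - u)"
  using concave_on_tangent_above[OF concave _ _ deriv_at_1, of u] at_1 by (simp add: algebra_simps)

lemma a_ge_1: "1 \<le> a"
  using upper_at_1[of 0] at_0 by simp

text \<open>The chord slopes \<open>s x\<close> grow as \<open>x\<close> decreases to
  \<open>u\<close> and stay below \<open>0\<close>, so they converge. The last clause supplies the
  differentiability points through which (B4) is transferred.\<close>

lemma ex_one_sided_derivative: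
  assumes u: "u \<in> I01"
  obtains p where "(f has_real_derivative p) (at u within one_side u)"
    and "- a \<le> p" "p \<le> 0" "1 \<le> f u - u * p"
    and "\<forall>e>0. \<exists>x\<in>I01. differentiable01 f x \<and> f u - e \<le> f x \<and> - u * p \<le> - x * deriv01 f x"
proof (cases "u < 1")
  case False
  with u have u1: "u = 1" by simp
  have "differentiable01 f 1" "deriv01 f 1 = - a"
    using deriv_at_1 deriv01_eqI[OF deriv_at_1] by (auto simp: real_differentiable_def)
  then show thesis
    using deriv_at_1 a_ge_1 by (intro that[of "- a"]) (auto simp: u1 one_side_def at_1 intro!: bexI[of _ 1])
next
  case True
  define s where "s x = (f x - f u) / (x - u)" for x
  \<comment> \<open>The monotone limit is taken of \<open>- s\<close>, which is nondecreasing and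
    bounded below by \<open>0\<close>; hence the infimum and the signs.\<close>
  define p where "p = - Inf ((\<lambda>x. - s x) ` ({u<..} \<inter> I01))"
  have s_anti: "s y \<le> s x" if "x \<in> I01" "y \<in> I01" "u < x" "x \<le> y" for x y
    unfolding s_def using concave_on_slope_antimono(1)[OF concave u] that by simp
  have s_le_0: "s x \<le> 0" if "x \<in> I01" "u < x" for x
    using less[OF u that] that by (simp add: s_def field_simps)
  have s_ge: "- a \<le> s x" if "x \<in> I01" "u < x" for x
  proof -
    have "- a \<le> s 1"
      using upper_at_1[OF u] True by (simp add: s_def at_1 field_simps)
    also have "s 1 \<le> s x" using s_anti that by simp
    finally show ?thesis .
  qed
  have "((\<lambda>x. - s x) \<longlongrightarrow> Inf ((\<lambda>x. - s x) ` ({u<..} \<inter> I01))) (at u within {u<..} \<inter> I01)"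
    by (rule Lim_right_bound[where K=0]) (use s_anti s_le_0 in auto)
  from tendsto_minus[OF this] have lim: "(s \<longlongrightarrow> p) (at u within one_side u)"
    using True by (simp add: p_def one_side_def)
  have ev: "\<forall>\<^sub>F x in at u within one_side u. x \<in> {u<..} \<inter> I01"
    using True by (auto simp: eventually_at_filter one_side_def)
  note nb = at_within_one_side_neq_bot[OF u]
  have upper: "s x \<le> p" if x: "x \<in> I01" "u < x" for x
  proof (rule tendsto_lowerbound[OF lim _ nb])
    have "\<forall>\<^sub>F y in at u within one_side u. y \<le> x"
      using eventually_at_in_open'[of "{..<x}" u] x
      by (auto simp: eventually_at_filter elim!: eventually_mono)
    then show "\<forall>\<^sub>F y in at u within one_side u. s x \<le> s y"
      using ev by eventually_elim (use s_anti x in auto)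
  qed
  have "(f has_real_derivative p) (at u within one_side u)"
    using lim unfolding has_field_derivative_iff s_def .
  moreover have "- a \<le> p"
    using s_ge[of 1] upper[of 1] True by simp
  moreover have "p \<le> 0"
    by (rule tendsto_upperbound[OF lim _ nb]) (use ev s_le_0 in \<open>auto elim: eventually_mono\<close>)
  moreover have "1 \<le> f u - u * p"
  proof (cases "u = 0")
    case True then show ?thesis by (simp add: at_0)
  next
    case False
    with u have "u > 0" by simp
    \<comment> \<open>Comparison with the chord from \<open>0\<close> to \<open>u\<close>, whose
      slope is \<open>(f u - 1) / u\<close>, bounds \<open>p\<close> from above.\<close>
    have "s x \<le> (f u - 1) / u" if "x \<in> I01" "u < x" for x
      using concave_on_slope_antimono(2)[OF concave, of 0 x u] that \<open>u > 0\<close> at_0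
      by (simp add: s_def)
    then have "p \<le> (f u - 1) / u"
      by (intro tendsto_upperbound[OF lim _ nb]) (use ev in \<open>auto elim: eventually_mono\<close>)
    then show ?thesis using \<open>u > 0\<close> by (simp add: field_simps)
  qed
  moreover have "\<exists>x\<in>I01. differentiable01 f x \<and> f u - e \<le> f x \<and> - u * p \<le> - x * deriv01 f x"
    if e: "e > 0" for e
  proof -
    \<comment> \<open>Chord slopes from \<open>u\<close> are at least \<open>- a\<close>, so
      \<open>f\<close> falls by at most \<open>e\<close> on \<open>{u<..<c}\<close>. This interval
      has positive length and so contains a differentiability point.\<close>
    define c where "c = min 1 (u + e / a)"
    have "u < c" using True e a_ge_1 by (simp add: c_def)
    have "\<exists>x\<in>{u<..<c}. differentiable01 f x"
    proof (rule ccontr)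
      assume none: "\<not> ?thesis"
      have "AE x in lborel. x \<notin> {u<..<c}"
        using AE_differentiable by eventually_elim (use none u in \<open>auto simp: c_def\<close>)
      then have "emeasure lborel {u<..<c} = 0"
        by (subst (asm) AE_iff_measurable[of "{u<..<c}"]) auto
      then show False using \<open>u < c\<close> by simp
    qed
    then obtain x where x: "u < x" "x < c" "differentiable01 f x" by auto
    have xI: "x \<in> I01" using x u by (auto simp: c_def)
    have "a * (x - u) \<le> e"
      using x a_ge_1 by (simp add: c_def field_simps)
    moreover have "- a * (x - u) \<le> f x - f u"
      using s_ge[OF xI x(1)] x(1) by (simp add: s_def field_simps)
    ultimately have 1: "f u - e \<le> f x" by simp
    \<comment> \<open>The tangent at \<open>x\<close> lies above the graph at \<open>u\<close>, so
      the derivative at \<open>x\<close> is at most the chord slope \<open>s x\<close>, hence at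
      most \<open>p\<close>.\<close>
    have "f u \<le> f x + deriv01 f x * (u - x)"
      by (rule concave_on_tangent_above[OF concave xI u differentiable01_deriv01[OF x(3)]])
    then have "deriv01 f x \<le> s x"
      using x(1) by (simp add: s_def field_simps)
    then have d: "deriv01 f x \<le> p" "deriv01 f x \<le> 0"
      using upper[OF xI x(1)] s_le_0[OF xI x(1)] by auto
    have "- u * p \<le> - u * deriv01 f x"
      using d(1) u by (simp add: mult_left_mono)
    also have "\<dots> \<le> - x * deriv01 f x"
      using d(2) x(1) by (simp add: mult_right_mono_neg)
    finally show ?thesis using 1 x(3) xI by blast
  qed
  ultimately show thesis by (intro that allI impI)
qed

text \<open>At \<open>0\<close> the right derivative is already the derivative within
  \<open>I01\<close>. This makes the corners \<open>(1,0)\<close> and \<open>(0,1)\<close>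
  available.\<close>

lemma ex_deriv_at_0: "\<exists>p. (f has_real_derivative p) (at 0 within I01)"
proof -
  obtain p where "(f has_real_derivative p) (at 0 within one_side 0)"
    using ex_one_sided_derivative[of 0] by auto
  moreover have "one_side 0 = I01 - {0}" by (auto simp: one_side_def)
  ultimately show ?thesis by (auto simp: has_field_derivative_iff at_within_def)
qed

end

text \<open>Here \<open>x\<close>, \<open>y\<close> stand for \<open>f u\<close>, \<open>g v\<close> and \<open>p\<close>, \<open>q\<close> for slopes of \<open>f\<close> at \<open>u\<close> and \<open>g\<close> at \<open>v\<close>,
  possibly one-sided.\<close>

definition G_at :: "real \<Rightarrow> real \<Rightarrow> real \<Rightarrow> real \<Rightarrow> real \<Rightarrow> real \<Rightarrow> real" where
  "G_at u x p v y q = (x - u * p) * (y - v * q) - 2 * u * v * p * q"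

lemma G_eq_G_at: "G f g u v = G_at u (f u) (deriv01 f u) v (g v) (deriv01 g v)"
  by (simp add: G_def G_at_def)

section \<open>First and mixed partial derivatives of \<open>D\<close>\<close>

text \<open>\<open>g\<close> enters only through its value \<open>y\<close> and slope
  \<open>q\<close> at \<open>v\<close>, and \<open>u\<close> comes last, ready for differentiation
  in \<open>u\<close>.\<close>

definition D_v :: "(real \<Rightarrow> real) \<Rightarrow> real \<Rightarrow> real \<Rightarrow> real \<Rightarrow> real \<Rightarrow> real \<Rightarrow> real" where
  "D_v f \<theta> v y q u = u * (1 - \<theta> * f u * (y - v * q)) / (1 - \<theta> * f u * y)\<^sup>2"

text \<open>The second summand of the numerator is nonnegative for nonpositive slopes and
  nonnegative \<open>u\<close>, \<open>x\<close>, \<open>v\<close>, \<open>y\<close>, which leaves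
  the sign to \<open>1 - \<theta> * G_at u x p v y q\<close>.\<close>

definition D_uv :: "real \<Rightarrow> real \<Rightarrow> real \<Rightarrow> real \<Rightarrow> real \<Rightarrow> real \<Rightarrow> real \<Rightarrow> real" where
  "D_uv \<theta> u x p v y q =
    ((1 - \<theta> * x * y) * (1 - \<theta> * G_at u x p v y q) + 2 * \<theta>\<^sup>2 * x * y * u * v * p * q) / (1 - \<theta> * x * y) ^ 3"

lemma D_has_derivative:
  assumes "(g has_real_derivative q) (at v within T)" "1 - \<theta> * f x * g v \<noteq> 0"
  shows "(D f g \<theta> x has_real_derivative D_v f \<theta> v (g v) q x) (at v within T)"
proof -
  define Q where "Q y = 1 - \<theta> * f x * g y" for y
  have "(Q has_real_derivative - (\<theta> * f x * q)) (at v within T)"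
    unfolding Q_def by (rule derivative_eq_intros assms(1) refl | simp)+
  moreover have "((\<lambda>y. x * y) has_real_derivative x) (at v within T)"
    by (rule derivative_eq_intros refl | simp)+
  ultimately have "((\<lambda>y. x * y / Q y) has_real_derivative
      (x * Q v - x * v * - (\<theta> * f x * q)) / (Q v * Q v)) (at v within T)"
    using assms(2) by (intro DERIV_divide) (assumption | simp add: Q_def)+
  also have "x * Q v - x * v * - (\<theta> * f x * q) = x * (1 - \<theta> * f x * (g v - v * q))"
    by (simp add: Q_def algebra_simps)
  finally show ?thesis
    unfolding D_def[abs_def] D_v_def Q_def power2_eq_square .
qed

lemma D_v_has_derivative:
  assumes "(f has_real_derivative p) (at u within S)" "1 - \<theta> * f u * y \<noteq> 0"
  shows "(D_v f \<theta> v y q has_real_derivative D_uv \<theta> u (f u) p v y q) (at u within S)"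
proof -
  define Q where "Q x = 1 - \<theta> * f x * y" for x
  define N where "N x = x * (1 - \<theta> * f x * (y - v * q))" for x
  define Q' where "Q' = - (\<theta> * p * y)"
  define N' where "N' = 1 - \<theta> * f u * (y - v * q) - u * \<theta> * p * (y - v * q)"
  have Q0: "Q u \<noteq> 0" using assms(2) by (simp add: Q_def)
  have Q: "(Q has_real_derivative Q') (at u within S)"
    unfolding Q_def Q'_def by (rule derivative_eq_intros assms(1) refl | simp)+
  have N: "(N has_real_derivative N') (at u within S)"
    unfolding N_def N'_def by (rule derivative_eq_intros assms(1) refl | simp)+
  have "((\<lambda>x. N x / (Q x * Q x)) has_real_derivative
      (N' * (Q u * Q u) - N u * (Q' * Q u + Q' * Q u)) / ((Q u * Q u) * (Q u * Q u))) (at u within S)"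
    using DERIV_divide[OF N DERIV_mult[OF Q Q]] Q0 by simp
  also have "(N' * (Q u * Q u) - N u * (Q' * Q u + Q' * Q u)) / ((Q u * Q u) * (Q u * Q u))
      = (Q u * (N' * Q u - 2 * N u * Q')) / (Q u * Q u ^ 3)"
    by (rule arg_cong2[where f = "(/)"]) (simp_all add: algebra_simps eval_nat_numeral)
  also have "\<dots> = (N' * Q u - 2 * N u * Q') / Q u ^ 3"
    using Q0 by simp
  also have "N' * Q u - 2 * N u * Q'
      = Q u * (1 - \<theta> * G_at u (f u) p v y q) + 2 * \<theta>\<^sup>2 * f u * y * u * v * p * q"
    unfolding N_def N'_def Q_def Q'_def G_at_def by (simp add: algebra_simps power2_eq_square)
  finally show ?thesis
    unfolding D_uv_def D_v_def[abs_def] N_def Q_def power2_eq_square .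
qed

text \<open>The inner derivative in \<open>has_mixed_partial\<close> has to exist at all points near
  \<open>u\<close>, so the denominator must be controlled there too.\<close>

lemma eventually_denominator_nonzero:
  assumes "(f has_real_derivative p) (at u within I01)" "1 - \<theta> * f u * y \<noteq> 0"
  shows "\<forall>\<^sub>F x in nhds u. x \<in> I01 \<longrightarrow> 1 - \<theta> * f x * y \<noteq> 0"
proof -
  have "((\<lambda>x. 1 - \<theta> * f x * y) \<longlongrightarrow> 1 - \<theta> * f u * y) (at u within I01)"
    using DERIV_continuous[OF assms(1)] by (intro tendsto_intros) (simp add: continuous_within)
  from tendsto_imp_eventually_ne[OF this assms(2)] show ?thesis
    unfolding eventually_at_filter
    by (rule eventually_mono) (use assms(2) in auto)
qed

lemma has_mixed_partial_D:
  assumes f: "(f has_real_derivative p) (at u within I01)" and g: "(g has_real_derivative q) (at v within I01)"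
    and Q: "1 - \<theta> * f u * g v \<noteq> 0"
  shows "has_mixed_partial (D f g \<theta>) u v (D_uv \<theta> u (f u) p v (g v) q)"
  unfolding has_mixed_partial_def
  using eventually_denominator_nonzero[OF f Q] D_v_has_derivative[OF f Q] D_has_derivative[OF g]
  by (auto elim!: eventually_mono intro!: exI[of _ "D_v f \<theta> v (g v) q"])

text \<open>Derivatives within \<open>I01\<close> restrict to subsets, and uniqueness only needs the
  base point to be a limit point. A mixed partial that exists can thus be computed from one-sided
  derivatives.\<close>

lemma mixed_partial_eqI:
  assumes C: "has_mixed_partial C u v d" and uv: "u \<in> I01"
    and S: "S \<subseteq> I01" "at u within S \<noteq> bot" and T: "T \<subseteq> I01" "at v within T \<noteq> bot"
    and k: "\<forall>\<^sub>F x in nhds u. x \<in> I01 \<longrightarrow> (C x has_real_derivative k x) (at v within T)"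
    and k': "(k has_real_derivative d') (at u within S)"
  shows "d = d'"
proof -
  obtain h where h: "\<forall>\<^sub>F x in nhds u. x \<in> I01 \<longrightarrow> (C x has_real_derivative h x) (at v within I01)"
    and d: "(h has_real_derivative d) (at u within I01)"
    using C by (auto simp: has_mixed_partial_def)
  have eq: "\<forall>\<^sub>F x in nhds u. x \<in> I01 \<longrightarrow> h x = k x"
    using h k
    by eventually_elim (use DERIV_subset[OF _ T(1)] has_field_derivative_unique[OF _ _ T(2)] in blast)
  have "h u = k u"
    using eventually_nhds_x_imp_x[OF eq] uv by blast
  moreover have "\<forall>\<^sub>F x in at u within S. h x = k x"
    unfolding eventually_at_filter by (rule eventually_mono[OF eq]) (use S in auto)
  ultimately have "(k has_real_derivative d) (at u within S)"
    using DERIV_subset[OF d S(1)] has_field_derivative_cong_eventually by blast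
  from has_field_derivative_unique[OF this k' S(2)] show ?thesis .
qed

text \<open>\<open>G_at\<close> is the left side of the first assumption minus \<open>1\<close>,
  plus \<open>(1 - f) * (1 - g) - u * v * p * q\<close>; this last difference is
  nonpositive.\<close>

lemma G_at_upper:
  assumes "f * (1 - v * q) + g * (1 - u * p) \<le> M + 1"
    and "1 \<le> f - u * p" "1 \<le> g - v * q" "f \<le> 1" "g \<le> 1"
  shows "G_at u f p v g q \<le> M"
proof -
  have "(1 - f) * (1 - g) \<le> (- u * p) * (- v * q)"
    by (rule mult_mono) (use assms in auto)
  then show ?thesis
    using assms(1) by (simp add: G_at_def algebra_simps)
qed

text \<open>After expansion, \<open>- u * v * p * q\<close> is the only term of \<open>G_at\<close>
  that can be negative.\<close>

lemma G_at_lower: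
  assumes "0 \<le> u" "u \<le> 1" "0 \<le> v" "v \<le> 1" "0 \<le> f" "0 \<le> g"
    and "- a \<le> p" "p \<le> 0" "- b \<le> q" "q \<le> 0"
  shows "- (a * b) \<le> G_at u f p v g q"
proof -
  have "(u * (- p)) * (v * (- q)) \<le> (1 * a) * (1 * b)"
    by (intro mult_mono mult_nonneg_nonneg) (use assms in auto)
  moreover have "0 \<le> f * g" "v * f * q \<le> 0" "u * g * p \<le> 0"
    using assms by (simp_all add: mult_nonneg_nonpos)
  ultimately show ?thesis by (simp add: G_at_def algebra_simps)
qed

section \<open>Range of \<open>G\<close> for a pair of generators\<close>

locale generator_pair = f: generator f a + g: generator g b
  for f a g b +
  assumes B4: "\<And>u v. u \<in> I01 \<Longrightarrow> v \<in> I01 \<Longrightarrow> differentiable01 f u \<Longrightarrow> differentiable01 g v \<Longrightarrow>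
      f u * (1 - v * deriv01 g v) + g v * (1 - u * deriv01 f u) \<le> max a b + 1"
begin

text \<open>Condition (B4) survives the passage to one-sided derivatives because it holds at
  differentiability points arbitrarily close to \<open>(u, v)\<close>, where the one-sided slopes only get steeper.\<close>

lemma ex_one_sided_derivatives:
  assumes uv: "u \<in> I01" "v \<in> I01"
  obtains p q where "(f has_real_derivative p) (at u within one_side u)"
    and "(g has_real_derivative q) (at v within one_side v)"
    and "p \<le> 0" "q \<le> 0" "- (a * b) \<le> G_at u (f u) p v (g v) q" "G_at u (f u) p v (g v) q \<le> max a b"
proof -
  obtain p where p: "(f has_real_derivative p) (at u within one_side u)"
      "- a \<le> p" "p \<le> 0" "1 \<le> f u - u * p"
    and px: "\<forall>e>0. \<exists>x\<in>I01. differentiable01 f x \<and> f u - e \<le> f x \<and> - u * p \<le> - x * deriv01 f x"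
    using f.ex_one_sided_derivative[OF uv(1)] .
  obtain q where q: "(g has_real_derivative q) (at v within one_side v)"
      "- b \<le> q" "q \<le> 0" "1 \<le> g v - v * q"
    and qy: "\<forall>e>0. \<exists>y\<in>I01. differentiable01 g y \<and> g v - e \<le> g y \<and> - v * q \<le> - y * deriv01 g y"
    using g.ex_one_sided_derivative[OF uv(2)] .
  have nonneg: "0 \<le> - u * p" "0 \<le> - v * q"
    using uv p(3) q(3) by (simp_all add: mult_nonneg_nonpos)
  \<comment> \<open>Lowering both \<open>f u\<close> and \<open>g v\<close> by \<open>r\<close>
    lowers the left side of (B4) by \<open>r * K\<close>, so the choice \<open>e / K\<close> costs
    exactly \<open>e\<close>.\<close>
  define K where "K = (1 - v * q) + (1 - u * p)"
  have K: "K > 0" using nonneg by (simp add: K_def)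
  have "f u * (1 - v * q) + g v * (1 - u * p) \<le> max a b + 1"
  proof (rule field_le_epsilon)
    fix e :: real assume "e > 0"
    then have e: "e / K > 0" using K by simp
    obtain x where x: "x \<in> I01" "differentiable01 f x" "f u - e / K \<le> f x" "- u * p \<le> - x * deriv01 f x"
      using px e by blast
    obtain y where y: "y \<in> I01" "differentiable01 g y" "g v - e / K \<le> g y" "- v * q \<le> - y * deriv01 g y"
      using qy e by blast
    have "(f u - e / K) * (1 - v * q) \<le> f x * (1 - y * deriv01 g y)"
      by (rule order_trans[OF mult_right_mono[OF x(3)] mult_left_mono])
        (use nonneg y f.range(1)[OF x(1)] in auto)
    moreover have "(g v - e / K) * (1 - u * p) \<le> g y * (1 - x * deriv01 f x)"
      by (rule order_trans[OF mult_right_mono[OF y(3)] mult_left_mono])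
        (use nonneg x g.range(1)[OF y(1)] in auto)
    ultimately have "(f u - e / K) * (1 - v * q) + (g v - e / K) * (1 - u * p) \<le> max a b + 1"
      using B4[OF x(1) y(1) x(2) y(2)] by linarith
    moreover have "(f u - r) * (1 - v * q) + (g v - r) * (1 - u * p)
        = f u * (1 - v * q) + g v * (1 - u * p) - r * K" for r
      by (simp add: K_def algebra_simps)
    from this[of "e / K"] have "(f u - e / K) * (1 - v * q) + (g v - e / K) * (1 - u * p)
        = f u * (1 - v * q) + g v * (1 - u * p) - e"
      using K by simp
    ultimately show "f u * (1 - v * q) + g v * (1 - u * p) \<le> max a b + 1 + e"
      by linarith
  qed
  from G_at_upper[OF this p(4) q(4)] have "G_at u (f u) p v (g v) q \<le> max a b"
    using f.range(2) g.range(2) uv by simp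
  moreover have "- (a * b) \<le> G_at u (f u) p v (g v) q"
    by (rule G_at_lower) (use uv p q f.range(1) g.range(1) in auto)
  ultimately show thesis using p q by (intro that)
qed

text \<open>At differentiability points the one-sided slopes are the derivatives, so the bounds on
  \<open>G_at\<close> carry over.\<close>

lemma G_values_bounds:
  assumes "y \<in> G_values f g"
  shows "- (a * b) \<le> y" "y \<le> max a b"
proof -
  obtain u v where uv: "u \<in> I01" "v \<in> I01" "differentiable01 f u" "differentiable01 g v" and y: "y = G f g u v"
    using assms by (auto simp: G_values_def)
  obtain p q where pq: "(f has_real_derivative p) (at u within one_side u)"
    "(g has_real_derivative q) (at v within one_side v)"
    "- (a * b) \<le> G_at u (f u) p v (g v) q" "G_at u (f u) p v (g v) q \<le> max a b"
    using ex_one_sided_derivatives[OF uv(1,2)] .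
  have "p = deriv01 f u" "q = deriv01 g v"
    using pq(1,2) uv DERIV_subset[OF differentiable01_deriv01 one_side_subset]
      has_field_derivative_unique[OF _ _ at_within_one_side_neq_bot] by blast+
  then show "- (a * b) \<le> y" "y \<le> max a b"
    using pq(3,4) by (simp_all add: y G_eq_G_at)
qed

lemma corners_in_G_values: "- (a * b) \<in> G_values f g" "a \<in> G_values f g" "b \<in> G_values f g"
proof -
  obtain p q where "(f has_real_derivative p) (at 0 within I01)" "(g has_real_derivative q) (at 0 within I01)"
    using f.ex_deriv_at_0 g.ex_deriv_at_0 by blast
  then have diff: "differentiable01 f 0" "differentiable01 g 0" "differentiable01 f 1" "differentiable01 g 1"
    using f.deriv_at_1 g.deriv_at_1 by (auto simp: real_differentiable_def)
  have d: "deriv01 f 1 = - a" "deriv01 g 1 = - b"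
    using f.deriv_at_1 g.deriv_at_1 by (auto intro: deriv01_eqI)
  \<comment> \<open>A derivative at \<open>0\<close> is multiplied by \<open>0\<close> here, so its
    value does not affect \<open>G\<close>.\<close>
  have "G f g 1 1 = - (a * b)" "G f g 1 0 = a" "G f g 0 1 = b"
    by (auto simp: G_def d f.at_0 f.at_1 g.at_0 g.at_1)
  moreover have "G f g u v \<in> G_values f g" if "u \<in> {0, 1}" "v \<in> {0, 1}" for u v
    unfolding G_values_def mem_Collect_eq by (intro exI[of _ u] exI[of _ v]) (use that diff in auto)
  ultimately show "- (a * b) \<in> G_values f g" "a \<in> G_values f g" "b \<in> G_values f g"
    by (metis insertCI)+
qed

section \<open>Necessity of the bounds on the parameter\<close>

text \<open>At the three corners used, \<open>f u * g v = 0\<close>, so the denominator is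
  \<open>1\<close> for every \<open>\<theta>\<close> and the mixed partial exists.\<close>

lemma copula_imp_bounds:
  assumes "copula (D f g \<theta>)"
  shows "- 1 / (a * b) \<le> \<theta>" "\<theta> \<le> 1 / max a b"
proof -
  note ab = f.a_ge_1 g.a_ge_1
  note at01 = f.at_0 f.at_1 g.at_0 g.at_1
  have nonneg: "d \<ge> 0" if "has_mixed_partial (D f g \<theta>) u v d" "u \<in> I01" "v \<in> I01" for u v d
    using assms that unfolding copula_def by blast
  obtain p q where pq: "(f has_real_derivative p) (at 0 within I01)" "(g has_real_derivative q) (at 0 within I01)"
    using f.ex_deriv_at_0 g.ex_deriv_at_0 by blast
  have "0 \<le> 1 + \<theta> * (a * b)"
    using nonneg[OF has_mixed_partial_D[OF f.deriv_at_1 g.deriv_at_1]]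
    by (simp add: D_uv_def G_at_def at01 algebra_simps)
  then show "- 1 / (a * b) \<le> \<theta>"
    using ab by (simp add: field_simps)
  have "0 \<le> 1 - \<theta> * b"
    using nonneg[OF has_mixed_partial_D[OF pq(1) g.deriv_at_1]]
    by (simp add: D_uv_def G_at_def at01 algebra_simps)
  moreover have "0 \<le> 1 - \<theta> * a"
    using nonneg[OF has_mixed_partial_D[OF f.deriv_at_1 pq(2)]]
    by (simp add: D_uv_def G_at_def at01 algebra_simps)
  ultimately show "\<theta> \<le> 1 / max a b"
    using ab by (auto simp: max_def field_simps)
qed

text \<open>For \<open>\<theta> = 1\<close> the denominator vanishes at the origin and the general formula is unavailable.\<close>

lemma mixed_partial_nonneg_origin:
  assumes "has_mixed_partial (D f g 1) 0 0 d"
  shows "0 \<le> d"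
proof -
  obtain h where h: "\<forall>\<^sub>F x in nhds 0. x \<in> I01 \<longrightarrow> (D f g 1 x has_real_derivative h x) (at 0 within I01)"
    and d: "(h has_real_derivative d) (at 0 within I01)"
    using assms by (auto simp: has_mixed_partial_def)
  obtain q where q: "(g has_real_derivative q) (at 0 within I01)"
    using g.ex_deriv_at_0 by blast
  note nb = at_within_I01_neq_bot[of 0, simplified]
  have "(D f g 1 0 has_real_derivative h 0) (at 0 within I01)"
    using eventually_nhds_x_imp_x[OF h] by simp
  \<comment> \<open>On the edge \<open>u = 0\<close> the function is identically \<open>0\<close>,
    at the origin because \<open>0 / 0 = 0\<close>.\<close>
  moreover have "(D f g 1 0 has_real_derivative 0) (at 0 within I01)"
    by (simp add: D_def[abs_def])
  ultimately have h0: "h 0 = 0" using has_field_derivative_unique[OF _ _ nb] by blast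
  \<comment> \<open>For \<open>x > 0\<close> near \<open>0\<close>,
    \<open>h x = x / (1 - f x)\<close>, so the quotient is \<open>1 / (1 - f x)\<close>.\<close>
  have "\<forall>\<^sub>F x in at 0 within I01. 0 \<le> (h x - h 0) / (x - 0)"
    unfolding eventually_at_filter using h
  proof eventually_elim
    fix x :: real assume hx: "x \<in> I01 \<longrightarrow> (D f g 1 x has_real_derivative h x) (at 0 within I01)"
    show "x \<noteq> 0 \<longrightarrow> x \<in> I01 \<longrightarrow> 0 \<le> (h x - h 0) / (x - 0)"
    proof safe
      assume x: "x \<noteq> 0" "x \<in> I01"
      then have f: "f x < 1" using f.range(3)[of x] by simp
      then have "(D f g 1 x has_real_derivative D_v f 1 0 (g 0) q x) (at 0 within I01)"
        by (intro D_has_derivative q) (simp add: g.at_0)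
      then have "h x = D_v f 1 0 (g 0) q x"
        using hx x(2) has_field_derivative_unique[OF _ _ nb] by blast
      then show "0 \<le> (h x - h 0) / (x - 0)"
        using x f by (simp add: D_v_def h0 g.at_0)
    qed
  qed
  with d[unfolded has_field_derivative_iff] show ?thesis
    using nb by (rule tendsto_lowerbound)
qed

section \<open>Sufficiency of the bounds on the parameter\<close>

context
  fixes \<theta> :: real
  assumes \<theta>: "- 1 / (a * b) \<le> \<theta>" "\<theta> \<le> 1 / max a b"
begin

text \<open>Since \<open>max a b \<ge> 1\<close>, the upper bound forces
  \<open>\<theta> \<le> 1\<close>; strict monotonicity gives \<open>f u * g v < 1\<close> away from
  the origin.\<close>

lemma denominator_pos:
  assumes uv: "u \<in> I01" "v \<in> I01" and "u \<noteq> 0 \<or> v \<noteq> 0"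
  shows "0 < 1 - \<theta> * f u * g v"
proof -
  have "\<theta> \<le> 1"
    using \<theta>(2) f.a_ge_1 by (smt (verit) divide_le_eq_1_pos)
  moreover have "0 \<le> f u * g v" using f.range(1) g.range(1) uv by simp
  moreover have "f u * g v < 1"
  proof (cases "u = 0")
    case True
    then show ?thesis using assms g.range(3)[of v] f.at_0 by auto
  next
    case False
    then have "f u * g v \<le> f u * 1" "f u < 1"
      using uv f.range(1,3)[of u] g.range(2)[of v] by (auto simp: mult_left_le)
    then show ?thesis by linarith
  qed
  ultimately show ?thesis
    using mult_right_mono[of \<theta> 1 "f u * g v"] by (simp add: algebra_simps)
qed

text \<open>The tangent bound \<open>f u \<le> a * (1 - u)\<close> yields
  \<open>\<theta> * f u * g v \<le> 1 - u\<close>, so the denominator is at least \<open>u\<close>,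
  hence at least \<open>u * v\<close>.\<close>

lemma D_range:
  assumes uv: "u \<in> I01" "v \<in> I01"
  shows "D f g \<theta> u v \<in> I01"
proof (cases "u = 0 \<and> v = 0")
  case True
  then show ?thesis by (simp add: D_def)
next
  case False
  then have pos: "0 < 1 - \<theta> * f u * g v" using denominator_pos[OF uv] by auto
  have fg: "0 \<le> f u * g v" using f.range(1) g.range(1) uv by simp
  have "\<theta> * (f u * g v) \<le> 1 / max a b * (a * (1 - u) * 1)"
    using \<theta> uv f.a_ge_1 f.upper_at_1 g.range f.range fg
    by (intro order_trans[OF mult_right_mono[OF \<theta>(2) fg]] mult_left_mono mult_mono) auto
  also have "\<dots> = a / max a b * (1 - u)" by simp
  also have "\<dots> \<le> 1 * (1 - u)"
    using f.a_ge_1 uv by (intro mult_right_mono) auto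
  finally have "\<theta> * (f u * g v) \<le> 1 - u" by simp
  moreover have "u * v \<le> u" using uv by (simp add: mult_left_le)
  ultimately show ?thesis
    using pos uv by (simp add: D_def field_simps)
qed

lemma mixed_partial_nonneg:
  assumes uv: "u \<in> I01" "v \<in> I01" and mixed: "has_mixed_partial (D f g \<theta>) u v d"
  shows "0 \<le> d"
proof (cases "u = 0 \<and> v = 0 \<and> \<theta> = 1")
  case True
  then show ?thesis using mixed mixed_partial_nonneg_origin by simp
next
  case False
  have Q: "0 < 1 - \<theta> * f u * g v"
  proof (cases "u = 0 \<and> v = 0")
    case True
    moreover have "\<theta> \<le> 1"
      using \<theta>(2) f.a_ge_1 by (smt (verit) divide_le_eq_1_pos)
    ultimately show ?thesis using False by (simp add: f.at_0 g.at_0)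
  qed (use uv denominator_pos in auto)
  obtain p q where p: "(f has_real_derivative p) (at u within one_side u)"
    and q: "(g has_real_derivative q) (at v within one_side v)"
    and pq: "p \<le> 0" "q \<le> 0" "- (a * b) \<le> G_at u (f u) p v (g v) q" "G_at u (f u) p v (g v) q \<le> max a b"
    using ex_one_sided_derivatives[OF uv] .
  \<comment> \<open>The one-sided slope \<open>p\<close> says nothing about \<open>f\<close> on the
    other side of \<open>u\<close>. For \<open>u \<noteq> 0\<close> all nearby \<open>x\<close> are
    nonzero, and the denominator is positive there anyway.\<close>
  have ev: "\<forall>\<^sub>F x in nhds u. x \<in> I01 \<longrightarrow> 1 - \<theta> * f x * g v \<noteq> 0"
  proof (cases "u = 0")
    case True
    with f.ex_deriv_at_0 obtain p0 where "(f has_real_derivative p0) (at u within I01)" by blast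
    then show ?thesis by (rule eventually_denominator_nonzero) (use Q in simp)
  next
    case False
    then have "\<forall>\<^sub>F x in nhds u. x \<noteq> 0" by (rule t1_space_nhds)
    then show ?thesis by eventually_elim (use uv denominator_pos in force)
  qed
  have "d = D_uv \<theta> u (f u) p v (g v) q"
  proof (rule mixed_partial_eqI[OF mixed uv(1) one_side_subset _ one_side_subset])
    show "\<forall>\<^sub>F x in nhds u. x \<in> I01 \<longrightarrow>
        (D f g \<theta> x has_real_derivative D_v f \<theta> v (g v) q x) (at v within one_side v)"
      using ev by eventually_elim (use D_has_derivative[OF q] in blast)
    show "(D_v f \<theta> v (g v) q has_real_derivative D_uv \<theta> u (f u) p v (g v) q) (at u within one_side u)"
      by (rule D_v_has_derivative[OF p]) (use Q in simp)
  qed (use uv at_within_one_side_neq_bot in auto)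
  \<comment> \<open>The upper bound on \<open>G_at\<close> serves nonnegative
    \<open>\<theta>\<close>, the lower bound negative \<open>\<theta>\<close>.\<close>
  moreover have "\<theta> * G_at u (f u) p v (g v) q \<le> 1"
  proof (cases "0 \<le> \<theta>")
    case True
    then have "\<theta> * G_at u (f u) p v (g v) q \<le> \<theta> * max a b"
      using pq by (intro mult_left_mono)
    also have "\<dots> \<le> 1" using \<theta>(2) f.a_ge_1 by (simp add: field_simps)
    finally show ?thesis .
  next
    case False
    then have "\<theta> * G_at u (f u) p v (g v) q \<le> \<theta> * (- (a * b))"
      using pq by (intro mult_left_mono_neg) auto
    also have "\<dots> \<le> 1"
      using \<theta>(1) mult_pos_pos[of a b] f.a_ge_1 g.a_ge_1 by (simp add: field_simps)
    finally show ?thesis .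
  qed
  moreover have "0 \<le> (\<theta>\<^sup>2 * f u * g v * u * v) * (p * q)"
    using pq uv f.range(1) g.range(1) by (simp add: mult_nonpos_nonpos)
  ultimately show ?thesis
    using Q by (simp add: D_uv_def mult.assoc)
qed

lemma AE_mixed_partial:
  "AE (u, v) in lborel. u \<in> I01 \<and> v \<in> I01 \<longrightarrow> (\<exists>d. has_mixed_partial (D f g \<theta>) u v d)"
proof -
  \<comment> \<open>Removing the null line \<open>u = 0\<close> avoids the origin, where the
    denominator vanishes if \<open>\<theta> = 1\<close>.\<close>
  have "AE u in lborel. (u \<in> I01 \<longrightarrow> differentiable01 f u) \<and> u \<noteq> 0"
    using f.AE_differentiable AE_lborel_singleton[of 0] by eventually_elim simp
  from AE_pair_lborelI[OF this g.AE_differentiable] show ?thesis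
  proof eventually_elim
    case (elim uv)
    obtain u v where uv: "uv = (u, v)" by (cases uv)
    show ?case unfolding uv prod.case
    proof (intro impI)
      assume I: "u \<in> I01 \<and> v \<in> I01"
      with elim have diff: "differentiable01 f u" "differentiable01 g v" and "u \<noteq> 0"
        by (simp_all add: uv)
      then have "1 - \<theta> * f u * g v \<noteq> 0"
        using denominator_pos[of u v] I by simp
      from has_mixed_partial_D[OF differentiable01_deriv01[OF diff(1)] differentiable01_deriv01[OF diff(2)] this]
      show "\<exists>d. has_mixed_partial (D f g \<theta>) u v d"
        by (rule exI)
    qed
  qed
qed

lemma copula_D: "copula (D f g \<theta>)"
proof -
  have "D f g \<theta> u 0 = 0" "D f g \<theta> 0 u = 0" "D f g \<theta> u 1 = u" "D f g \<theta> 1 u = u" for u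
    by (simp_all add: D_def f.at_1 g.at_1)
  then show ?thesis
    unfolding copula_def using D_range AE_mixed_partial mixed_partial_nonneg
    by (intro conjI ballI allI impI) assumption+
qed

end

end

theorem theorem7p1:
  fixes f g :: "real \<Rightarrow> real" and a b \<alpha>1 \<alpha>2 \<theta> :: real
  assumes diff_f: "AE x in lborel. x \<in> I01 \<longrightarrow> differentiable01 f x"
    and diff_g: "AE x in lborel. x \<in> I01 \<longrightarrow> differentiable01 g x"
    and diff_f1: "differentiable01 f 1"
    and diff_g1: "differentiable01 g 1"
    and B1: "f 0 = 1" "g 0 = 1" "f 1 = 0" "g 1 = 0"
    and B2: "strict_antimono_on I01 f" "strict_antimono_on I01 g"
    and B3: "concave_on I01 f" "concave_on I01 g"
    and a: "a = - deriv01 f 1"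
    and b: "b = - deriv01 g 1"
    and B4: "\<And>u v. u \<in> I01 \<Longrightarrow> v \<in> I01 \<Longrightarrow> differentiable01 f u \<Longrightarrow> differentiable01 g v \<Longrightarrow>
      f u * (1 - v * deriv01 g v) + g v * (1 - u * deriv01 f u) \<le> max a b + 1"
    and alpha1: "\<alpha>1 \<in> G_values f g" "\<And>y. y \<in> G_values f g \<Longrightarrow> \<alpha>1 \<le> y"
    and alpha2: "\<alpha>2 \<in> G_values f g" "\<And>y. y \<in> G_values f g \<Longrightarrow> y \<le> \<alpha>2"
  shows "copula (D f g \<theta>) \<longleftrightarrow> \<theta> \<in> {1 / \<alpha>1 .. 1 / \<alpha>2}"
proof -
  interpret generator_pair f a g b
    by unfold_locales
      (use B1 B2 B3 diff_f diff_g B4 a b differentiable01_deriv01[OF diff_f1]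
        differentiable01_deriv01[OF diff_g1] in \<open>simp | blast\<close>)+
  \<comment> \<open>The bounds on \<open>G\<close> are themselves values of \<open>G\<close> at
    corners, so they are its minimum and maximum.\<close>
  have "\<alpha>1 = - (a * b)"
    using alpha1 G_values_bounds(1) corners_in_G_values(1) by (meson order_antisym)
  moreover have "\<alpha>2 = max a b"
    using alpha2(2)[OF corners_in_G_values(2)] alpha2(2)[OF corners_in_G_values(3)]
      G_values_bounds(2)[OF alpha2(1)] by simp
  ultimately have "\<theta> \<in> {1 / \<alpha>1 .. 1 / \<alpha>2} \<longleftrightarrow> - 1 / (a * b) \<le> \<theta> \<and> \<theta> \<le> 1 / max a b"
    by simp
  then show ?thesis
    using copula_imp_bounds copula_D by blast
qed

end
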